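(* For every $n\in\mathbb{N}$, the monoid $\mathcal{M}_n$ is not group-embeddable (as a monoid); that is, there is no group $G$ admitting an injective monoid morphism $\phi:\mathcal{M}_n\to G$.
   Context: $\mathbb{N}$ denotes the set of positive integers. For $n\in\mathbb{N}$, let $X_n=\{a,b,c,d,A_1,\dots,A_n,B_1,\dots,B_n,C_1,\dots,C_n,D_1,\dots,D_n\}$ be an alphabet of $4n+4$ distinct letters, and let $\mathcal{M}_n$ be the monoid with monoid presentation $\langle X_n \mid \rho_n\rangle$, where $\rho_n$ consists of the following relations (a pair $(w_1,w_2)$ means the relation $w_1=w_2$): $(da,\,A_1C_1)$; $(A_iD_i,\,A_{i+1}C_{i+1})$ for $1\le i\le n-1$; $(A_nD_n,\,db)$; $(cb,\,B_nD_n)$; $(B_iC_i,\,B_{i-1}D_{i-1})$ for $2\le i\le n$. (For $n=1$ the relations are $(da,A_1C_1)$, $(A_1D_1,db)$, $(cb,B_1D_1)$.) That is, $\mathcal{M}_n$ is the quotient of the free monoid $X_n^*$ by the congruence generated by $\rho_n$. *)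

theory Defs
  imports "HOL-Algebra.Group"
begin

text \<open>Words over \<open>X\<close> are the lists in \<^term>\<open>lists X\<close>, so the free monoid on \<open>X\<close> is
  \<^term>\<open>lists X\<close> under \<^term>\<open>(@)\<close>.\<close>

text \<open>The congruence on the free monoid on \<open>X\<close> generated by \<open>R\<close>. The side conditions in \<open>base\<close>
  only matter for an \<open>R\<close> that is not a relation on words over \<open>X\<close>.\<close>

inductive_set generated_cong :: "'x set \<Rightarrow> ('x list \<times> 'x list) set \<Rightarrow> ('x list \<times> 'x list) set"
  for X :: "'x set" and R :: "('x list \<times> 'x list) set" where
  base: "(u, v) \<in> R \<Longrightarrow> u \<in> lists X \<Longrightarrow> v \<in> lists X \<Longrightarrow> (u, v) \<in> generated_cong X R"
| refl: "u \<in> lists X \<Longrightarrow> (u, u) \<in> generated_cong X R"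
| sym: "(u, v) \<in> generated_cong X R \<Longrightarrow> (v, u) \<in> generated_cong X R"
| trans: "(u, v) \<in> generated_cong X R \<Longrightarrow> (v, w) \<in> generated_cong X R
    \<Longrightarrow> (u, w) \<in> generated_cong X R"
| append: "(u, v) \<in> generated_cong X R \<Longrightarrow> (u', v') \<in> generated_cong X R
    \<Longrightarrow> (u @ u', v @ v') \<in> generated_cong X R"

text \<open>The monoid presented by \<open>\<langle>X | R\<rangle>\<close>. The union defining the product is the single class of
  \<open>u @ v\<close>, for any representatives \<open>u\<close>, \<open>v\<close>; see \<open>presented_monoid_mult_class\<close>.\<close>

definition presented_monoid :: "'x set \<Rightarrow> ('x list \<times> 'x list) set \<Rightarrow> 'x list set monoid" where
  "presented_monoid X R =
    \<lparr>carrier = lists X // generated_cong X R,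
     mult = (\<lambda>U V. \<Union>u\<in>U. \<Union>v\<in>V. generated_cong X R `` {u @ v}),
     one = generated_cong X R `` {[]}\<rparr>"

lemma generated_cong_subset: "generated_cong X R \<subseteq> lists X \<times> lists X"
proof
  fix p assume "p \<in> generated_cong X R"
  then show "p \<in> lists X \<times> lists X"
    by (cases p) (simp, erule generated_cong.induct, auto)
qed

lemma equiv_generated_cong: "equiv (lists X) (generated_cong X R)"
proof (rule equivI)
  show "refl_on (lists X) (generated_cong X R)"
    by (auto simp: refl_on_def intro: generated_cong.refl)
  show "sym (generated_cong X R)"
    by (rule symI) (rule generated_cong.sym)
  show "trans (generated_cong X R)"
    by (rule transI) (rule generated_cong.trans)
qed (rule generated_cong_subset)

lemma generated_cong_least:
  assumes "equiv (lists X) E" and "R \<subseteq> E"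
    and "\<And>u v u' v'. (u, v) \<in> E \<Longrightarrow> (u', v') \<in> E \<Longrightarrow> (u @ u', v @ v') \<in> E"
  shows "generated_cong X R \<subseteq> E"
proof
  fix p assume "p \<in> generated_cong X R"
  moreover have "(u, v) \<in> E" if "(u, v) \<in> generated_cong X R" for u v
    using that
  proof induction
    case (refl u) then show ?case
      using assms(1) by (meson equiv_def refl_onD)
  next
    case (sym u v) then show ?case
      using assms(1) by (meson equiv_def symD)
  next
    case (trans u v w) then show ?case
      using assms(1) by (meson equiv_def transD)
  qed (use assms in auto)
  ultimately show "p \<in> E"
    by (cases p) auto
qed

lemma presented_monoid_mult_class:
  assumes "u \<in> lists X" and "v \<in> lists X"
  shows "(generated_cong X R `` {u}) \<otimes>\<^bsub>presented_monoid X R\<^esub> (generated_cong X R `` {v})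
    = generated_cong X R `` {u @ v}"
proof -
  have "congruent2 (generated_cong X R) (generated_cong X R)
      (\<lambda>u v. generated_cong X R `` {u @ v})"
    using equiv_class_eq[OF equiv_generated_cong] generated_cong.append
    unfolding congruent2_def by fast
  from UN_equiv_class2[OF equiv_generated_cong equiv_generated_cong this assms]
  show ?thesis
    by (simp add: presented_monoid_def)
qed

lemma monoid_presented_monoid: "monoid (presented_monoid X R)"
proof -
  let ?M = "presented_monoid X R" and ?cl = "\<lambda>u. generated_cong X R `` {u}"
  have car: "carrier ?M = lists X // generated_cong X R" and one: "\<one>\<^bsub>?M\<^esub> = ?cl []"
    by (simp_all add: presented_monoid_def)
  have in_car: "?cl u \<in> carrier ?M" if "u \<in> lists X" for u
    using that unfolding car by (rule quotientI)
  have rep: "\<exists>u\<in>lists X. U = ?cl u" if "U \<in> carrier ?M" for U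
    using that unfolding car by (auto elim: quotientE)
  show ?thesis
  proof (rule monoidI)
    fix U V assume "U \<in> carrier ?M" "V \<in> carrier ?M"
    with rep obtain u v where "u \<in> lists X" "U = ?cl u" "v \<in> lists X" "V = ?cl v"
      by metis
    then show "U \<otimes>\<^bsub>?M\<^esub> V \<in> carrier ?M"
      using in_car[of "u @ v"] by (simp add: presented_monoid_mult_class)
  next
    show "\<one>\<^bsub>?M\<^esub> \<in> carrier ?M"
      unfolding one by (rule in_car) simp
  next
    fix U V W assume "U \<in> carrier ?M" "V \<in> carrier ?M" "W \<in> carrier ?M"
    with rep obtain u v w where
      "u \<in> lists X" "U = ?cl u" "v \<in> lists X" "V = ?cl v" "w \<in> lists X" "W = ?cl w"
      by metis
    then show "U \<otimes>\<^bsub>?M\<^esub> V \<otimes>\<^bsub>?M\<^esub> W = U \<otimes>\<^bsub>?M\<^esub> (V \<otimes>\<^bsub>?M\<^esub> W)"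
      by (simp add: presented_monoid_mult_class)
  next
    fix U assume "U \<in> carrier ?M"
    with rep obtain u where u: "u \<in> lists X" "U = ?cl u"
      by metis
    then show "\<one>\<^bsub>?M\<^esub> \<otimes>\<^bsub>?M\<^esub> U = U"
      using presented_monoid_mult_class[of "[]" X u R] by (simp add: one)
    from u show "U \<otimes>\<^bsub>?M\<^esub> \<one>\<^bsub>?M\<^esub> = U"
      using presented_monoid_mult_class[of u X "[]" R] by (simp add: one)
  qed
qed

text \<open>\<^const>\<open>hom\<close> only asks for compatibility with multiplication; a monoid morphism also
  preserves the identity.\<close>

definition monoid_hom :: "('a, 'm) monoid_scheme \<Rightarrow> ('b, 'n) monoid_scheme \<Rightarrow> ('a \<Rightarrow> 'b) set" where
  "monoid_hom M N = {h \<in> hom M N. h \<one>\<^bsub>M\<^esub> = \<one>\<^bsub>N\<^esub>}"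

datatype letter = La | Lb | Lc | Ld | LA nat | LB nat | LC nat | LD nat

definition alphabet :: "nat \<Rightarrow> letter set" where
  "alphabet n = {La, Lb, Lc, Ld} \<union> LA ` {1..n} \<union> LB ` {1..n} \<union> LC ` {1..n} \<union> LD ` {1..n}"

text \<open>In the second family \<open>i\<close> runs over \<open>1 \<le> i \<le> n - 1\<close>.\<close>

definition relations :: "nat \<Rightarrow> (letter list \<times> letter list) set" where
  "relations n =
      {([Ld, La], [LA 1, LC 1])}
    \<union> {([LA i, LD i], [LA (i + 1), LC (i + 1)]) | i. 1 \<le> i \<and> i < n}
    \<union> {([LA n, LD n], [Ld, Lb])}
    \<union> {([Lc, Lb], [LB n, LD n])}
    \<union> {([LB i, LC i], [LB (i - 1), LD (i - 1)]) | i. 2 \<le> i \<and> i \<le> n}"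

definition monoid_M :: "nat \<Rightarrow> letter list set monoid" where
  "monoid_M n = presented_monoid (alphabet n) (relations n)"

lemma card_alphabet: "card (alphabet n) = 4 * n + 4"
proof -
  have "alphabet n = {La, Lb, Lc, Ld} \<union> (LA ` {1..n} \<union> (LB ` {1..n} \<union> (LC ` {1..n} \<union> LD ` {1..n})))"
    by (auto simp: alphabet_def)
  also have "card \<dots> = 4 + (n + (n + (n + n)))"
    by (subst card_Un_disjoint; (auto simp: card_image inj_on_def)?)+
  finally show ?thesis
    by simp
qed

lemma relations_subset:
  assumes "n \<ge> 1"
  shows "relations n \<subseteq> lists (alphabet n) \<times> lists (alphabet n)"
  using assms by (auto simp: relations_def alphabet_def image_iff Bex_def)

end

theory Submission
  imports Defs
begin

text \<open>Suppose that a group contained the monoid, and put \<open>g = c d\<^sup>-\<^sup>1\<close>, so that \<open>c = g d\<close>. Left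
  multiplication by \<open>g\<close> turns \<open>d b = A\<^sub>n D\<^sub>n\<close> into \<open>g A\<^sub>n D\<^sub>n = c b = B\<^sub>n D\<^sub>n\<close>, so \<open>B\<^sub>n = g A\<^sub>n\<close>. If
  \<open>B\<^sub>i = g A\<^sub>i\<close> with \<open>i \<ge> 2\<close>, then
  \<open>B\<^sub>i\<^sub>-\<^sub>1 D\<^sub>i\<^sub>-\<^sub>1 = B\<^sub>i C\<^sub>i = g A\<^sub>i C\<^sub>i = g A\<^sub>i\<^sub>-\<^sub>1 D\<^sub>i\<^sub>-\<^sub>1\<close>, so \<open>B\<^sub>i\<^sub>-\<^sub>1 = g A\<^sub>i\<^sub>-\<^sub>1\<close>. Descending to \<open>i = 1\<close>,
  \<open>B\<^sub>1 C\<^sub>1 = g A\<^sub>1 C\<^sub>1 = g d a = c a\<close>: the group is forced to satisfy the one relation that would close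
  the cycle of defining relations (\<open>group_closes_relation_chain\<close>).

  In the monoid this relation fails, since no side of a defining relation occurs in the word \<open>c a\<close>,
  which is therefore alone in its class (\<open>not_cong_closing_relation\<close>).\<close>

text \<open>The complement of a set \<open>F\<close> closed under taking factors is an ideal of the free monoid.
  Its Rees congruence, which collapses this ideal to one class and is trivial on \<open>F\<close>, contains
  every relation both of whose sides lie outside \<open>F\<close>.\<close>

lemma generated_cong_factor_closed:
  assumes cong: "(u, v) \<in> generated_cong X R" and "u \<in> F"
    and closed: "\<And>x y. x @ y \<in> F \<Longrightarrow> x \<in> F \<and> y \<in> F"
    and avoid: "\<And>x y. (x, y) \<in> R \<Longrightarrow> x \<notin> F \<and> y \<notin> F"
  shows "u = v"
proof -
  have "u = v \<or> u \<notin> F \<and> v \<notin> F"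
    using cong
  proof induction
    case (append u v u' v')
    then show ?case
      using closed by blast
  qed (use avoid in auto)
  with \<open>u \<in> F\<close> show ?thesis
    by blast
qed

lemma not_cong_closing_relation:
  "([Lc, La], [LB 1, LC 1]) \<notin> generated_cong X (relations n)"
proof
  \<comment> \<open>\<open>F\<close> is the set of all factors of \<open>c a\<close>.\<close>
  let ?F = "{[], [Lc], [La], [Lc, La]}"
  assume "([Lc, La], [LB 1, LC 1]) \<in> generated_cong X (relations n)"
  then have "[Lc, La] = [LB 1, LC 1]"
  proof (rule generated_cong_factor_closed[where F = ?F])
    show "x \<in> ?F \<and> y \<in> ?F" if "x @ y \<in> ?F" for x y
      using that by (auto simp: append_eq_Cons_conv)
    show "x \<notin> ?F \<and> y \<notin> ?F" if "(x, y) \<in> relations n" for x y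
      using that by (auto simp: relations_def)
  qed simp
  then show False
    by simp
qed

text \<open>The quotient \<open>B i (A i)\<^sup>-\<^sup>1\<close> is the same for all \<open>i\<close>, namely \<open>c d\<^sup>-\<^sup>1\<close>: the relation between
  \<open>c b\<close> and \<open>d b\<close> fixes it at \<open>i = n\<close>, and right cancellation of \<open>D i\<close> carries it from \<open>Suc i\<close>
  to \<open>i\<close>.\<close>

lemma (in group) group_closes_relation_chain:
  assumes carr: "a \<in> carrier G" "b \<in> carrier G" "c \<in> carrier G" "d \<in> carrier G"
      "\<And>i. 1 \<le> i \<Longrightarrow> i \<le> n \<Longrightarrow>
        A i \<in> carrier G \<and> B i \<in> carrier G \<and> C i \<in> carrier G \<and> D i \<in> carrier G"
    and n: "n \<ge> 1"
    and da: "d \<otimes> a = A 1 \<otimes> C 1"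
    and AD: "\<And>i. 1 \<le> i \<Longrightarrow> i < n \<Longrightarrow> A i \<otimes> D i = A (Suc i) \<otimes> C (Suc i)"
    and db: "A n \<otimes> D n = d \<otimes> b"
    and cb: "c \<otimes> b = B n \<otimes> D n"
    and BC: "\<And>i. 1 \<le> i \<Longrightarrow> i < n \<Longrightarrow> B (Suc i) \<otimes> C (Suc i) = B i \<otimes> D i"
  shows "c \<otimes> a = B 1 \<otimes> C 1"
proof -
  define g where "g = c \<otimes> inv d"
  have g: "g \<in> carrier G" and c_eq: "c = g \<otimes> d"
    using carr(3,4) by (auto simp: g_def m_assoc)
  have cancel: "B i = g \<otimes> A i" if "1 \<le> i" "i \<le> n" "B i \<otimes> D i = g \<otimes> (A i \<otimes> D i)" for i
    using that carr(5)[of i] g right_cancel[of "D i" "B i" "g \<otimes> A i"] by (simp add: m_assoc)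
  have "B 1 = g \<otimes> A 1"
    using n
  proof (induction rule: inc_induct)
    case base
    have "B n \<otimes> D n = g \<otimes> (A n \<otimes> D n)"
      using cb db c_eq carr g by (simp add: m_assoc)
    with n show ?case
      by (intro cancel) auto
  next
    case (step i)
    have "B i \<otimes> D i = g \<otimes> (A i \<otimes> D i)"
      using step BC[of i] AD[of i] carr(5)[of "Suc i"] g by (simp add: m_assoc)
    with step show ?case
      by (intro cancel) auto
  qed
  then show ?thesis
    using da c_eq carr(1,4) carr(5)[of 1] n g by (simp add: m_assoc)
qed

theorem proposition3p3:
  fixes n :: nat
  assumes "n \<ge> 1"
  shows "\<not> (\<exists>(G :: ('g, 'm) monoid_scheme) \<phi>. group G \<and>
    \<phi> \<in> monoid_hom (monoid_M n) G \<and> inj_on \<phi> (carrier (monoid_M n)))"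
proof
  assume "\<exists>(G :: ('g, 'm) monoid_scheme) \<phi>. group G \<and>
    \<phi> \<in> monoid_hom (monoid_M n) G \<and> inj_on \<phi> (carrier (monoid_M n))"
  then obtain G :: "('g, 'm) monoid_scheme" and \<phi> where "group G"
    and hom: "\<phi> \<in> hom (monoid_M n) G" and inj: "inj_on \<phi> (carrier (monoid_M n))"
    by (auto simp: monoid_hom_def)
  interpret group G
    by fact
  let ?X = "alphabet n" and ?R = "relations n"
  let ?cl = "\<lambda>u. generated_cong ?X ?R `` {u}"
  define f where "f x = \<phi> (?cl [x])" for x
  have cl_in: "?cl u \<in> carrier (monoid_M n)" if "u \<in> lists ?X" for u
    using that by (simp add: monoid_M_def presented_monoid_def quotientI)
  have f_in: "f x \<in> carrier G" if "x \<in> ?X" for x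
    using that hom cl_in[of "[x]"] by (auto simp: f_def hom_def)
  have phi_pair: "\<phi> (?cl [x, y]) = f x \<otimes>\<^bsub>G\<^esub> f y" if "x \<in> ?X" "y \<in> ?X" for x y
    using that hom_mult[OF hom cl_in[of "[x]"] cl_in[of "[y]"]]
      presented_monoid_mult_class[of "[x]" ?X "[y]" ?R]
    by (simp add: f_def monoid_M_def)
  have rel: "f x \<otimes>\<^bsub>G\<^esub> f y = f z \<otimes>\<^bsub>G\<^esub> f w" if "([x, y], [z, w]) \<in> ?R" for x y z w
  proof -
    have letters: "x \<in> ?X" "y \<in> ?X" "z \<in> ?X" "w \<in> ?X"
      using that relations_subset[OF assms] by auto
    with that have "?cl [x, y] = ?cl [z, w]"
      by (intro equiv_class_eq[OF equiv_generated_cong] generated_cong.base) auto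
    then show ?thesis
      using letters by (simp flip: phi_pair)
  qed
  have "f Lc \<otimes>\<^bsub>G\<^esub> f La = f (LB 1) \<otimes>\<^bsub>G\<^esub> f (LC 1)"
  proof (rule group_closes_relation_chain[where n = n and b = "f Lb" and d = "f Ld"
        and A = "\<lambda>i. f (LA i)" and B = "\<lambda>i. f (LB i)" and C = "\<lambda>i. f (LC i)" and D = "\<lambda>i. f (LD i)"])
    show "f (LB (Suc i)) \<otimes>\<^bsub>G\<^esub> f (LC (Suc i)) = f (LB i) \<otimes>\<^bsub>G\<^esub> f (LD i)"
      if "1 \<le> i" "i < n" for i
      using that by (intro rel) (auto simp: relations_def)
  qed (use assms in \<open>auto intro!: f_in rel simp: alphabet_def relations_def\<close>)
  moreover have letters: "Lc \<in> ?X" "La \<in> ?X" "LB 1 \<in> ?X" "LC 1 \<in> ?X"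
    using assms by (auto simp: alphabet_def)
  ultimately have "\<phi> (?cl [Lc, La]) = \<phi> (?cl [LB 1, LC 1])"
    by (simp only: phi_pair)
  then have "?cl [Lc, La] = ?cl [LB 1, LC 1]"
    using letters by (intro inj_onD[OF inj] cl_in) auto
  then have "([Lc, La], [LB 1, LC 1]) \<in> generated_cong ?X ?R"
    using letters by (intro eq_equiv_class[OF _ equiv_generated_cong]) auto
  then show False
    using not_cong_closing_relation by blast
qed

end
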